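(* Let $G$ be a finite group and let $A\unlhd G$ be an abelian normal subgroup. If $G$ is almost monomial, then $G$ is relative almost monomial with respect to $A$.
   Context: All characters are complex characters of finite groups, and $\operatorname{Irr}(G)$ is the set of irreducible characters of $G$. A linear character is a character of degree $1$. For $H\leqslant G$, $\chi_H$ denotes restriction to $H$ and $\theta^G$ denotes induction from $H$ to $G$. For a character $\chi$ of $G$, $\operatorname{Cons}(\chi):=\{\phi\in\operatorname{Irr}(G):\langle\phi,\chi\rangle>0\}$ is its set of constituents. A finite group $G$ is called almost monomial if for any $\chi\neq\phi\in\operatorname{Irr}(G)$ there exist a subgroup $H\leqslant G$ and a linear character $\lambda$ of $H$ such that $\chi\in\operatorname{Cons}(\lambda^G)$ and $\phi\notin\operatorname{Cons}(\lambda^G)$. Let $N\unlhd G$. The group $G$ is called relative almost monomial with respect to $N$ if for any $\chi\neq\phi\in\operatorname{Irr}(G)$ there exist a subgroup $H$ with $N\subseteq H\leqslant G$ and $\psi\in\operatorname{Irr}(H)$ such that $\psi_N\in\operatorname{Irr}(N)$, $\chi\in\operatorname{Cons}(\psi^G)$ and $\phi\notin\operatorname{Cons}(\psi^G)$. *)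

theory Defs
  imports "Jordan_Normal_Form.VS_Connect" "HOL-Algebra.Coset"
begin

text \<open>
  Subgroups of \<open>G\<close> are regarded as groups via \<open>G\<lparr>carrier := H\<rparr>\<close>.
  A function on \<open>G\<close> is represented by a function that is \<open>undefined\<close> outside \<open>carrier G\<close>,
  so that equality of characters is equality on \<open>carrier G\<close>.
\<close>

definition mat_trace :: "complex mat \<Rightarrow> complex" where
  "mat_trace M = sum_list (diag_mat M)"

definition representation ::
  "('a, 'b) monoid_scheme \<Rightarrow> nat \<Rightarrow> ('a \<Rightarrow> complex mat) \<Rightarrow> bool" where
  "representation G n \<rho> \<longleftrightarrow>
     (\<forall>g\<in>carrier G. \<rho> g \<in> carrier_mat n n) \<and>
     \<rho> \<one>\<^bsub>G\<^esub> = 1\<^sub>m n \<and>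
     (\<forall>g\<in>carrier G. \<forall>h\<in>carrier G. \<rho> (g \<otimes>\<^bsub>G\<^esub> h) = \<rho> g * \<rho> h)"

definition invariant_subspace ::
  "('a, 'b) monoid_scheme \<Rightarrow> nat \<Rightarrow> ('a \<Rightarrow> complex mat) \<Rightarrow> complex vec set \<Rightarrow> bool" where
  "invariant_subspace G n \<rho> W \<longleftrightarrow>
     VectorSpace.subspace class_ring W (module_vec TYPE(complex) n) \<and>
     (\<forall>g\<in>carrier G. \<forall>w\<in>W. \<rho> g *\<^sub>v w \<in> W)"

definition irreducible_representation ::
  "('a, 'b) monoid_scheme \<Rightarrow> nat \<Rightarrow> ('a \<Rightarrow> complex mat) \<Rightarrow> bool" where
  "irreducible_representation G n \<rho> \<longleftrightarrow>
     representation G n \<rho> \<and> 0 < n \<and>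
     (\<forall>W. invariant_subspace G n \<rho> W \<longrightarrow> W = {0\<^sub>v n} \<or> W = carrier_vec n)"

definition afforded_char ::
  "('a, 'b) monoid_scheme \<Rightarrow> ('a \<Rightarrow> complex mat) \<Rightarrow> 'a \<Rightarrow> complex" where
  "afforded_char G \<rho> = (\<lambda>g\<in>carrier G. mat_trace (\<rho> g))"

definition characters :: "('a, 'b) monoid_scheme \<Rightarrow> ('a \<Rightarrow> complex) set" where
  "characters G = {afforded_char G \<rho> |\<rho> n. representation G n \<rho>}"

definition Irr :: "('a, 'b) monoid_scheme \<Rightarrow> ('a \<Rightarrow> complex) set" where
  "Irr G = {afforded_char G \<rho> |\<rho> n. irreducible_representation G n \<rho>}"

definition linear_characters :: "('a, 'b) monoid_scheme \<Rightarrow> ('a \<Rightarrow> complex) set" where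
  "linear_characters G = {\<mu> \<in> characters G. \<mu> \<one>\<^bsub>G\<^esub> = 1}"

definition char_inner ::
  "('a, 'b) monoid_scheme \<Rightarrow> ('a \<Rightarrow> complex) \<Rightarrow> ('a \<Rightarrow> complex) \<Rightarrow> complex" where
  "char_inner G \<phi> \<chi> = (\<Sum>g\<in>carrier G. \<phi> g * cnj (\<chi> g)) / of_nat (card (carrier G))"

text \<open>
  The order on \<open>complex\<close> is that of \<open>HOL-Library.Complex_Order\<close>:
  \<open>0 < z\<close> means that \<open>z\<close> is real and positive.
\<close>

definition constituents :: "('a, 'b) monoid_scheme \<Rightarrow> ('a \<Rightarrow> complex) \<Rightarrow> ('a \<Rightarrow> complex) set" where
  "constituents G \<chi> = {\<phi> \<in> Irr G. 0 < char_inner G \<phi> \<chi>}"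

definition induced_char ::
  "('a, 'b) monoid_scheme \<Rightarrow> 'a set \<Rightarrow> ('a \<Rightarrow> complex) \<Rightarrow> 'a \<Rightarrow> complex" where
  "induced_char G H \<theta> = (\<lambda>g\<in>carrier G.
     (\<Sum>x | x \<in> carrier G \<and> inv\<^bsub>G\<^esub> x \<otimes>\<^bsub>G\<^esub> g \<otimes>\<^bsub>G\<^esub> x \<in> H. \<theta> (inv\<^bsub>G\<^esub> x \<otimes>\<^bsub>G\<^esub> g \<otimes>\<^bsub>G\<^esub> x))
       / of_nat (card H))"

definition almost_monomial :: "('a, 'b) monoid_scheme \<Rightarrow> bool" where
  "almost_monomial G \<longleftrightarrow>
     (\<forall>\<chi>\<in>Irr G. \<forall>\<phi>\<in>Irr G. \<chi> \<noteq> \<phi> \<longrightarrow>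
        (\<exists>H \<mu>. subgroup H G \<and> \<mu> \<in> linear_characters (G\<lparr>carrier := H\<rparr>) \<and>
           \<chi> \<in> constituents G (induced_char G H \<mu>) \<and> \<phi> \<notin> constituents G (induced_char G H \<mu>)))"

definition relative_almost_monomial :: "('a, 'b) monoid_scheme \<Rightarrow> 'a set \<Rightarrow> bool" where
  "relative_almost_monomial G N \<longleftrightarrow>
     (\<forall>\<chi>\<in>Irr G. \<forall>\<phi>\<in>Irr G. \<chi> \<noteq> \<phi> \<longrightarrow>
        (\<exists>H \<psi>. subgroup H G \<and> N \<subseteq> H \<and> \<psi> \<in> Irr (G\<lparr>carrier := H\<rparr>) \<and>
           restrict \<psi> N \<in> Irr (G\<lparr>carrier := N\<rparr>) \<and>
           \<chi> \<in> constituents G (induced_char G H \<psi>) \<and> \<phi> \<notin> constituents G (induced_char G H \<psi>)))"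

end

theory Submission
  imports Defs "HOL-Algebra.Multiplicative_Group" "HOL-Algebra.SndIsomorphismGrp" "Jordan_Normal_Form.Schur_Decomposition"
begin

text \<open>
  Frobenius reciprocity turns the statement into one about vectors. For a linear character
  \<open>\<psi>\<close> of a subgroup \<open>T\<close>, the inner product of the character of a representation \<open>\<rho>\<close> with the
  character induced from \<open>\<psi>\<close> is the trace of the projection of the representation space onto
  its \<open>\<psi>\<close>-eigenvectors, the vectors \<open>x\<close> with \<open>\<rho> t x = \<psi> t x\<close> for all \<open>t\<close> in \<open>T\<close>. Hence \<open>\<rho>\<close>
  affords a constituent of the induced character iff it has a nonzero \<open>\<psi>\<close>-eigenvector
  (\<open>char_inner_induced_pos_iff\<close>).

  Let the linear character \<open>\<mu>\<close> of \<open>H\<close> separate \<open>\<chi>\<close> from \<open>\<phi>\<close>, and let \<open>v\<close> be a nonzero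
  \<open>\<mu>\<close>-eigenvector in the representation affording \<open>\<chi>\<close>. As \<open>A\<close> is abelian, some linear
  character \<open>\<nu>\<close> of \<open>A\<close> has a nonzero projection \<open>w\<close> of \<open>v\<close> onto its eigenspace
  (\<open>abelian_average_nonzero\<close>). The elements of \<open>H\<close> that fix \<open>\<nu>\<close> under conjugation act on
  \<open>w\<close> through \<open>\<mu>\<close>, because their action commutes with the projection. So, if \<open>T\<close> is the product
  of \<open>A\<close> and the stabiliser of \<open>\<nu>\<close> in \<open>H\<close>, then \<open>T\<close> acts on the line through \<open>w\<close> by a linear
  character \<open>\<psi>\<close> which agrees with \<open>\<mu>\<close> on the stabiliser and with \<open>\<nu>\<close> on \<open>A\<close>
  (\<open>enlarge_linear_character\<close>). In particular \<open>\<chi>\<close> is a constituent of the character induced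
  from \<open>\<psi>\<close>, and \<open>\<psi>\<close> restricts to a linear, hence irreducible, character of \<open>A\<close>.

  Finally \<open>\<phi>\<close> is still avoided: the character induced from \<open>\<psi>\<close> is a part of the one induced
  from \<open>\<mu>\<close>. Concretely, average a nonzero \<open>\<psi>\<close>-eigenvector \<open>u\<close> over \<open>H\<close> against \<open>\<mu>\<close>. The
  translates of \<open>u\<close> by elements of \<open>H\<close> outside \<open>T\<close> lie in other eigenspaces of \<open>A\<close>, and
  the remaining terms all equal \<open>u\<close>, so the average is a nonzero \<open>\<mu>\<close>-eigenvector
  (\<open>average_nonzero_if_enlarged_eigenvector\<close>).
\<close>

section \<open>Traces of idempotent matrices\<close>

lemma mat_trace_eq: "A \<in> carrier_mat n n \<Longrightarrow> mat_trace A = (\<Sum>i<n. A $$ (i, i))"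
  by (auto simp: mat_trace_def diag_mat_def interv_sum_list_conv_sum_set_nat atLeast0LessThan)

lemma mat_trace_commute:
  assumes "A \<in> carrier_mat n n" "B \<in> carrier_mat n n"
  shows "mat_trace (A * B) = mat_trace (B * A)"
proof -
  have "mat_trace (A * B) = (\<Sum>i<n. \<Sum>j<n. A $$ (i, j) * B $$ (j, i))"
    using assms by (subst mat_trace_eq[of _ n]) (auto simp: scalar_prod_def atLeast0LessThan)
  also have "\<dots> = (\<Sum>i<n. \<Sum>j<n. B $$ (i, j) * A $$ (j, i))"
    by (subst sum.swap) (simp add: mult.commute)
  also have "\<dots> = mat_trace (B * A)"
    using assms by (subst mat_trace_eq[of _ n]) (auto simp: scalar_prod_def atLeast0LessThan)
  finally show ?thesis .
qed

text \<open>
  The trace is the sum of the eigenvalues, read off from a Schur triangularisation, and the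
  eigenvalues of an idempotent are 0 or 1; so the trace is positive iff 1 is an eigenvalue.
\<close>

lemma mat_trace_idempotent_pos_iff:
  assumes P: "P \<in> carrier_mat n n"
    and idem: "\<And>x. x \<in> carrier_vec n \<Longrightarrow> P *\<^sub>v (P *\<^sub>v x) = P *\<^sub>v x"
  shows "0 < mat_trace P \<longleftrightarrow> (\<exists>x \<in> carrier_vec n. x \<noteq> 0\<^sub>v n \<and> P *\<^sub>v x = x)"
proof -
  obtain es where es: "char_poly P = (\<Prod>e\<leftarrow>es. [:- e, 1:])"
    using char_poly_factorized[OF P] by blast
  obtain B U V where sd: "schur_decomposition P es = (B, U, V)"
    by (cases "schur_decomposition P es") auto
  have wit: "similar_mat_wit P B U V" and diag: "diag_mat B = es"
    using schur_decomposition[OF P es sd] by auto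
  note w = similar_mat_witD2[OF P wit]
  have "mat_trace P = mat_trace (U * (B * V))"
    using w by (simp add: assoc_mult_mat[of _ n n _ n _ n])
  also have "\<dots> = mat_trace (B * V * U)"
    using w by (intro mat_trace_commute) auto
  also have "\<dots> = mat_trace B"
    using w by (simp add: assoc_mult_mat[of _ n n _ n _ n])
  finally have tr: "mat_trace P = sum_list es" by (simp add: mat_trace_def diag)
  have mem: "e \<in> set es \<longleftrightarrow> (\<exists>x \<in> carrier_vec n. x \<noteq> 0\<^sub>v n \<and> P *\<^sub>v x = e \<cdot>\<^sub>v x)" for e
  proof -
    have "e \<in> set es \<longleftrightarrow> poly (char_poly P) e = 0"
      by (auto simp: es poly_prod_list prod_list_zero_iff)
    then show ?thesis
      using P by (auto simp: eigenvalue_root_char_poly[OF P, symmetric] eigenvalue_def eigenvector_def)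
  qed
  have sub: "e = 0 \<or> e = 1" if "e \<in> set es" for e
  proof -
    obtain x where x: "x \<in> carrier_vec n" "x \<noteq> 0\<^sub>v n" "P *\<^sub>v x = e \<cdot>\<^sub>v x"
      using \<open>e \<in> set es\<close> mem by blast
    obtain i where i: "i < n" "x $ i \<noteq> 0" using x by (metis eq_vecI carrier_vecD index_zero_vec)
    have "e \<cdot>\<^sub>v (e \<cdot>\<^sub>v x) = e \<cdot>\<^sub>v x"
      using idem[OF x(1)] x P by (simp add: mult_mat_vec[OF P])
    then have "(e \<cdot>\<^sub>v (e \<cdot>\<^sub>v x)) $ i = (e \<cdot>\<^sub>v x) $ i" by simp
    then show ?thesis using i x by auto
  qed
  have "0 \<le> sum_list es \<and> (0 < sum_list es \<longleftrightarrow> 1 \<in> set es)" using sub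
  proof (induction es)
    case (Cons e es)
    then have "0 \<le> sum_list es" "0 < sum_list es \<longleftrightarrow> 1 \<in> set es" "e = 0 \<or> e = 1"
      by auto
    moreover have "(0::complex) < 1 + z" if "0 \<le> z" for z
      using that by (simp add: less_complex_def less_eq_complex_def)
    ultimately show ?case by (auto simp: less_complex_def less_eq_complex_def)
  qed simp
  then have "0 < mat_trace P \<longleftrightarrow> 1 \<in> set es" by (simp add: tr)
  then show ?thesis by (auto simp: mem)
qed

section \<open>Finite sums of vectors\<close>

text \<open>
  Sums are taken coordinatewise, so that their algebra reduces to that of sums of complex
  numbers; the dimension is an argument because it cannot be read off from an empty sum.
\<close>

definition vsum :: "nat \<Rightarrow> 'i set \<Rightarrow> ('i \<Rightarrow> complex vec) \<Rightarrow> complex vec" where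
  "vsum n S f = vec n (\<lambda>i. \<Sum>s\<in>S. f s $ i)"

lemma vsum_carrier [simp]: "vsum n S f \<in> carrier_vec n"
  by (simp add: vsum_def)

lemma dim_vsum [simp]: "dim_vec (vsum n S f) = n"
  by (simp add: vsum_def)

lemma vsum_cong: "(\<And>s. s \<in> S \<Longrightarrow> f s = g s) \<Longrightarrow> vsum n S f = vsum n S g"
  by (simp add: vsum_def cong: sum.cong)

lemma vsum_zero: "(\<And>s. s \<in> S \<Longrightarrow> f s = 0\<^sub>v n) \<Longrightarrow> vsum n S f = 0\<^sub>v n"
  by (auto simp: vsum_def intro!: eq_vecI sum.neutral)

lemma vsum_smult_right:
  assumes "\<And>s. s \<in> S \<Longrightarrow> f s \<in> carrier_vec n"
  shows "vsum n S (\<lambda>s. c \<cdot>\<^sub>v f s) = c \<cdot>\<^sub>v vsum n S f"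
  using carrier_vecD[OF assms]
  by (intro eq_vecI) (auto simp: vsum_def sum_distrib_left intro!: sum.cong)

lemma vsum_smult_left:
  "x \<in> carrier_vec n \<Longrightarrow> vsum n S (\<lambda>s. c s \<cdot>\<^sub>v x) = sum c S \<cdot>\<^sub>v x"
  by (intro eq_vecI) (auto simp: vsum_def sum_distrib_right)

lemma mult_mat_vsum:
  assumes "M \<in> carrier_mat n n" "\<And>s. s \<in> S \<Longrightarrow> f s \<in> carrier_vec n"
  shows "M *\<^sub>v vsum n S f = vsum n S (\<lambda>s. M *\<^sub>v f s)"
proof (rule eq_vecI)
  fix i assume "i < dim_vec (vsum n S (\<lambda>s. M *\<^sub>v f s))"
  then have i: "i < n" by simp
  have "(M *\<^sub>v vsum n S f) $ i = (\<Sum>j<n. M $$ (i, j) * (\<Sum>s\<in>S. f s $ j))"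
    using i assms by (auto simp: scalar_prod_def vsum_def atLeast0LessThan intro!: sum.cong)
  also have "\<dots> = (\<Sum>s\<in>S. \<Sum>j<n. M $$ (i, j) * f s $ j)"
    by (simp add: sum_distrib_left sum.swap[of _ S])
  also have "\<dots> = vsum n S (\<lambda>s. M *\<^sub>v f s) $ i"
    using i assms
    by (auto simp: scalar_prod_def vsum_def atLeast0LessThan dest!: assms(2) intro!: sum.cong)
  finally show "(M *\<^sub>v vsum n S f) $ i = vsum n S (\<lambda>s. M *\<^sub>v f s) $ i" .
qed (use assms in auto)

lemma vsum_swap: "vsum n S (\<lambda>s. vsum n T (f s)) = vsum n T (\<lambda>t. vsum n S (\<lambda>s. f s t))"
  by (auto simp: vsum_def sum.swap[of _ T] intro!: eq_vecI)

lemma vsum_reindex_bij_witness: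
  assumes "\<And>a. a \<in> S \<Longrightarrow> i (j a) = a" "\<And>a. a \<in> S \<Longrightarrow> j a \<in> T"
    "\<And>b. b \<in> T \<Longrightarrow> j (i b) = b" "\<And>b. b \<in> T \<Longrightarrow> i b \<in> S" "\<And>a. a \<in> S \<Longrightarrow> h (j a) = g a"
  shows "vsum n S g = vsum n T h"
  unfolding vsum_def
  by (intro eq_vecI) (auto intro!: sum.reindex_bij_witness[of S i j T] assms arg_cong2[of _ _ _ _ vec_index])

lemma smult_vec_cancel:
  fixes x :: "complex vec"
  assumes "x \<in> carrier_vec n" "x \<noteq> 0\<^sub>v n" "c \<cdot>\<^sub>v x = d \<cdot>\<^sub>v x"
  shows "c = d"
proof -
  obtain i where i: "i < n" "x $ i \<noteq> 0" using assms by (metis eq_vecI carrier_vecD index_zero_vec)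
  have "c * x $ i = (c \<cdot>\<^sub>v x) $ i" using i assms(1) by simp
  also have "\<dots> = (d \<cdot>\<^sub>v x) $ i" by (simp only: assms(3))
  also have "\<dots> = d * x $ i" using i assms(1) by simp
  finally show ?thesis using i by simp
qed

lemma smult_vec_nonzero:
  fixes x :: "complex vec"
  assumes "x \<in> carrier_vec n" "x \<noteq> 0\<^sub>v n" "c \<noteq> 0"
  shows "c \<cdot>\<^sub>v x \<noteq> 0\<^sub>v n"
proof
  assume "c \<cdot>\<^sub>v x = 0\<^sub>v n"
  also have "0\<^sub>v n = 0 \<cdot>\<^sub>v x" using assms(1) by (intro eq_vecI) auto
  finally show False using smult_vec_cancel[OF assms(1,2)] assms(3) by blast
qed

lemma smult_zero_vec: "c \<cdot>\<^sub>v 0\<^sub>v n = (0\<^sub>v n :: complex vec)"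
  by (intro eq_vecI) auto

lemma zero_smult_vec: "x \<in> carrier_vec n \<Longrightarrow> 0 \<cdot>\<^sub>v x = (0\<^sub>v n :: complex vec)"
  by (intro eq_vecI) auto

section \<open>Linear characters as multiplicative functions\<close>

text \<open>
  A linear character of \<open>T\<close>, except that values outside \<open>T\<close> are unconstrained (not
  \<open>undefined\<close>), so that the restriction to a smaller subgroup is the same function.
\<close>

definition mult_char :: "('a, 'b) monoid_scheme \<Rightarrow> 'a set \<Rightarrow> ('a \<Rightarrow> complex) \<Rightarrow> bool" where
  "mult_char G T \<psi> \<longleftrightarrow>
     \<psi> \<one>\<^bsub>G\<^esub> = 1 \<and> (\<forall>s\<in>T. \<forall>t\<in>T. \<psi> (s \<otimes>\<^bsub>G\<^esub> t) = \<psi> s * \<psi> t)"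

lemma mult_char_restrict:
  "subgroup T G \<Longrightarrow> mult_char G T \<psi> \<Longrightarrow> mult_char G T (restrict \<psi> T)"
  by (auto simp: mult_char_def subgroup.one_closed subgroup.m_closed)

lemma mult_char_subset:
  "mult_char G T \<psi> \<Longrightarrow> S \<subseteq> T \<Longrightarrow> mult_char G S \<psi>"
  by (auto simp: mult_char_def)

lemma linear_characters_mult_char:
  assumes "subgroup H G" "\<mu> \<in> linear_characters (G\<lparr>carrier := H\<rparr>)"
  shows "mult_char G H \<mu>"
proof -
  obtain \<rho> n where rep: "representation (G\<lparr>carrier := H\<rparr>) n \<rho>"
    and \<mu>: "\<mu> = afforded_char (G\<lparr>carrier := H\<rparr>) \<rho>" and one: "\<mu> \<one>\<^bsub>G\<^esub> = 1"
    using assms(2) by (auto simp: linear_characters_def characters_def)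
  have \<mu>_eq: "\<mu> h = mat_trace (\<rho> h)" if "h \<in> H" for h
    using that by (simp add: \<mu> afforded_char_def)
  have car: "\<rho> h \<in> carrier_mat n n" if "h \<in> H" for h
    using rep that by (simp add: representation_def)
  have "of_nat n = (1::complex)"
    using one \<mu>_eq[of "\<one>\<^bsub>G\<^esub>"] rep subgroup.one_closed[OF assms(1)]
    by (simp add: representation_def mat_trace_eq[of _ n])
  then have n: "n = 1" by simp
  have tr: "\<mu> h = \<rho> h $$ (0, 0)" if "h \<in> H" for h
    using \<mu>_eq[OF that] mat_trace_eq[OF car[OF that]] n by simp
  have "\<mu> (s \<otimes>\<^bsub>G\<^esub> t) = \<mu> s * \<mu> t" if "s \<in> H" "t \<in> H" for s t
  proof -
    have "\<rho> (s \<otimes>\<^bsub>G\<^esub> t) = \<rho> s * \<rho> t" using rep that by (simp add: representation_def)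
    then show ?thesis
      using that car[OF that(1)] car[OF that(2)] n subgroup.m_closed[OF assms(1) that]
      by (simp add: tr scalar_prod_def)
  qed
  with one show ?thesis by (simp add: mult_char_def)
qed

text \<open>
  The 1 by 1 matrices with entries \<open>\<psi> t\<close> form a representation, which is irreducible since a
  line has no proper nonzero subspace.
\<close>

lemma mult_char_Irr:
  assumes "subgroup T G" "mult_char G T \<psi>"
  shows "restrict \<psi> T \<in> Irr (G\<lparr>carrier := T\<rparr>)"
proof -
  define \<rho> where "\<rho> t = mat 1 1 (\<lambda>_. \<psi> t)" for t
  have "representation (G\<lparr>carrier := T\<rparr>) 1 \<rho>"
    using assms(2)
    by (auto simp: representation_def \<rho>_def mult_char_def scalar_prod_def intro!: eq_matI)
  moreover have "W = {0\<^sub>v 1} \<or> W = carrier_vec 1"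
    if inv: "invariant_subspace (G\<lparr>carrier := T\<rparr>) 1 \<rho> W" for W
  proof (cases "W \<subseteq> {0\<^sub>v 1}")
    case True
    have "0\<^sub>v 1 \<in> W"
      using inv by (auto simp: invariant_subspace_def VectorSpace.subspace_def submodule_def module_vec_simps)
    then show ?thesis using True by auto
  next
    case False
    then obtain w where w: "w \<in> W" "w \<noteq> 0\<^sub>v 1" by blast
    have W: "W \<subseteq> carrier_vec 1" and sm: "\<And>c x. x \<in> W \<Longrightarrow> c \<cdot>\<^sub>v x \<in> W"
      using inv
      by (auto simp: invariant_subspace_def VectorSpace.subspace_def submodule_def module_vec_simps class_ring_simps)
    have "x \<in> W" if x: "x \<in> carrier_vec 1" for x
    proof -
      have "w $ 0 \<noteq> 0" using w W by (auto intro!: eq_vecI)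
      then have "x = (x $ 0 / w $ 0) \<cdot>\<^sub>v w"
        using x w W by (intro eq_vecI) auto
      then show ?thesis using sm[OF w(1)] by metis
    qed
    then show ?thesis using W by blast
  qed
  ultimately have "irreducible_representation (G\<lparr>carrier := T\<rparr>) 1 \<rho>"
    by (auto simp: irreducible_representation_def)
  moreover have "restrict \<psi> T = afforded_char (G\<lparr>carrier := T\<rparr>) \<rho>"
    by (auto simp: afforded_char_def \<rho>_def mat_trace_def diag_mat_def)
  ultimately show ?thesis by (auto simp: Irr_def)
qed

section \<open>Averaging over a subgroup against a linear character\<close>

locale finite_group_rep = group G for G (structure) +
  fixes n :: nat and \<rho> :: "'a \<Rightarrow> complex mat"
  assumes fin [simp]: "finite (carrier G)"
    and rep: "representation G n \<rho>"
begin

lemma rep_carrier [simp]: "g \<in> carrier G \<Longrightarrow> \<rho> g \<in> carrier_mat n n"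
  using rep by (simp add: representation_def)

lemma rep_apply_carrier [simp]:
  "g \<in> carrier G \<Longrightarrow> x \<in> carrier_vec n \<Longrightarrow> \<rho> g *\<^sub>v x \<in> carrier_vec n"
  by (rule mult_mat_vec_carrier[of _ n n]) auto

lemma rep_one [simp]: "x \<in> carrier_vec n \<Longrightarrow> \<rho> \<one> *\<^sub>v x = x"
  using rep by (simp add: representation_def)

lemma rep_mult:
  "g \<in> carrier G \<Longrightarrow> h \<in> carrier G \<Longrightarrow> x \<in> carrier_vec n \<Longrightarrow>
     \<rho> (g \<otimes> h) *\<^sub>v x = \<rho> g *\<^sub>v (\<rho> h *\<^sub>v x)"
  using rep by (simp add: representation_def assoc_mult_mat_vec[of _ n n _ n])

lemma rep_smult [simp]:
  "g \<in> carrier G \<Longrightarrow> x \<in> carrier_vec n \<Longrightarrow> \<rho> g *\<^sub>v (c \<cdot>\<^sub>v x) = c \<cdot>\<^sub>v (\<rho> g *\<^sub>v x)"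
  by (rule mult_mat_vec[of _ n n]) auto

text \<open>
  Up to the factor \<open>card T\<close>, which is left out to keep the identities below free of
  divisions, this is the projection onto the \<open>\<psi>\<close>-eigenvectors of \<open>T\<close>.
\<close>

definition average :: "'a set \<Rightarrow> ('a \<Rightarrow> complex) \<Rightarrow> complex vec \<Rightarrow> complex vec" where
  "average T \<psi> x = vsum n T (\<lambda>t. cnj (\<psi> t) \<cdot>\<^sub>v (\<rho> t *\<^sub>v x))"

lemma average_carrier [simp]: "average T \<psi> x \<in> carrier_vec n"
  by (simp add: average_def)

end

context group
begin

lemma mult_char_pow:
  assumes "subgroup T G" "mult_char G T \<psi>" "t \<in> T"
  shows "\<psi> (t [^] (k::nat)) = \<psi> t ^ k"
proof -
  have "t [^] k \<in> T \<and> \<psi> (t [^] k) = \<psi> t ^ k"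
    by (induction k)
      (use assms in \<open>simp_all add: mult_char_def subgroup.one_closed subgroup.m_closed\<close>)
  then show ?thesis ..
qed

text \<open>Values of \<open>\<psi>\<close> are roots of unity, since elements of \<open>G\<close> have finite order.\<close>

lemma mult_char_cnj:
  assumes "finite (carrier G)" "subgroup T G" "mult_char G T \<psi>" "t \<in> T"
  shows "cnj (\<psi> t) * \<psi> t = 1"
proof -
  have t: "t \<in> carrier G" by (rule subgroup.mem_carrier[OF assms(2,4)])
  have "\<psi> t ^ Coset.order G = 1"
    using mult_char_pow[OF assms(2-4), of "Coset.order G"] pow_order_eq_1[OF t] assms(3)
    by (simp add: mult_char_def)
  moreover have "Coset.order G > 0" using assms(1) order_gt_0_iff_finite by blast
  ultimately have "norm (\<psi> t) = 1"
    using power_eq_imp_eq_base[of "norm (\<psi> t)" "Coset.order G" 1] by (simp flip: norm_power)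
  then have "\<psi> t * cnj (\<psi> t) = 1" using complex_norm_square[of "\<psi> t"] by simp
  then show ?thesis by (simp only: mult.commute)
qed

lemma mult_char_inv:
  assumes "finite (carrier G)" "subgroup T G" "mult_char G T \<psi>" "t \<in> T"
  shows "\<psi> (inv t) = cnj (\<psi> t)"
proof -
  have t: "t \<in> carrier G" "inv t \<in> T"
    using subgroup.mem_carrier[OF assms(2,4)] subgroup.m_inv_closed[OF assms(2,4)] by auto
  have "\<psi> t * \<psi> (inv t) = 1"
    using assms(3,4) t r_inv[OF t(1)] unfolding mult_char_def by metis
  then have "cnj (\<psi> t) * (\<psi> t * \<psi> (inv t)) = cnj (\<psi> t)" by simp
  then show ?thesis by (simp only: mult.assoc[symmetric] mult_char_cnj[OF assms] mult_1_left)
qed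

text \<open>
  Orthogonality: translating the summation index by \<open>s\<close> multiplies the sum by \<open>f s\<close>, so the
  sum vanishes as soon as some \<open>f s\<close> differs from 1.
\<close>

lemma sum_mult_char:
  assumes "subgroup T G" "mult_char G T f"
  shows "sum f T = (if \<forall>t\<in>T. f t = 1 then of_nat (card T) else 0)"
proof (cases "\<forall>t\<in>T. f t = 1")
  case False
  then obtain s where s: "s \<in> T" "f s \<noteq> 1" by blast
  have car: "t \<in> carrier G" if "t \<in> T" for t by (rule subgroup.mem_carrier[OF assms(1) that])
  have "sum f T = (\<Sum>t\<in>T. f (s \<otimes> t))"
    using assms s car
    by (intro sum.reindex_bij_witness[of _ "\<lambda>t. s \<otimes> t" "\<lambda>t. inv s \<otimes> t"])
       (auto simp: subgroup.m_closed subgroup.m_inv_closed m_assoc[symmetric])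
  also have "\<dots> = f s * sum f T"
    using assms s by (simp add: mult_char_def sum_distrib_left)
  finally have "sum f T = 0" using s by simp
  then show ?thesis using False by (subst if_not_P)
qed (simp)

end

context finite_group_rep
begin

lemma average_rep:
  assumes T: "subgroup T G" "mult_char G T \<psi>" and "s \<in> T" "x \<in> carrier_vec n"
  shows "average T \<psi> (\<rho> s *\<^sub>v x) = \<psi> s \<cdot>\<^sub>v average T \<psi> x"
proof -
  have car: "t \<in> carrier G" if "t \<in> T" for t by (rule subgroup.mem_carrier[OF T(1) that])
  have "average T \<psi> (\<rho> s *\<^sub>v x) = vsum n T (\<lambda>t. (\<psi> s * cnj (\<psi> t)) \<cdot>\<^sub>v (\<rho> t *\<^sub>v x))"
    unfolding average_def
  proof (rule vsum_reindex_bij_witness[of _ "\<lambda>t. t \<otimes> inv s" "\<lambda>t. t \<otimes> s"])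
    fix t assume t: "t \<in> T"
    have "\<psi> s * cnj (\<psi> (t \<otimes> s)) = cnj (\<psi> t)"
      using t assms mult_char_cnj[OF fin T \<open>s \<in> T\<close>] by (simp add: mult_char_def mult.commute)
    then show "(\<psi> s * cnj (\<psi> (t \<otimes> s))) \<cdot>\<^sub>v (\<rho> (t \<otimes> s) *\<^sub>v x) = cnj (\<psi> t) \<cdot>\<^sub>v (\<rho> t *\<^sub>v (\<rho> s *\<^sub>v x))"
      using t assms car by (simp add: rep_mult)
  qed (use assms car in \<open>auto simp: subgroup.m_closed subgroup.m_inv_closed m_assoc\<close>)
  also have "\<dots> = \<psi> s \<cdot>\<^sub>v average T \<psi> x"
    using assms car by (simp add: average_def flip: smult_smult_assoc vsum_smult_right)
  finally show ?thesis .
qed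

lemma rep_average:
  assumes T: "subgroup T G" "mult_char G T \<psi>" and "s \<in> T" "x \<in> carrier_vec n"
  shows "\<rho> s *\<^sub>v average T \<psi> x = \<psi> s \<cdot>\<^sub>v average T \<psi> x"
proof -
  have car: "t \<in> carrier G" if "t \<in> T" for t by (rule subgroup.mem_carrier[OF T(1) that])
  have "\<rho> s *\<^sub>v average T \<psi> x = vsum n T (\<lambda>t. cnj (\<psi> t) \<cdot>\<^sub>v (\<rho> (s \<otimes> t) *\<^sub>v x))"
    using assms car by (simp add: average_def mult_mat_vsum rep_mult cong: vsum_cong)
  also have "\<dots> = vsum n T (\<lambda>t. (\<psi> s * cnj (\<psi> t)) \<cdot>\<^sub>v (\<rho> t *\<^sub>v x))"
  proof (rule vsum_reindex_bij_witness[of _ "\<lambda>t. inv s \<otimes> t" "\<lambda>t. s \<otimes> t"])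
    fix t assume t: "t \<in> T"
    have "\<psi> s * cnj (\<psi> (s \<otimes> t)) = cnj (\<psi> t)"
      using t assms mult_char_cnj[OF fin T \<open>s \<in> T\<close>] by (simp add: mult_char_def mult.commute)
    then show "(\<psi> s * cnj (\<psi> (s \<otimes> t))) \<cdot>\<^sub>v (\<rho> (s \<otimes> t) *\<^sub>v x) = cnj (\<psi> t) \<cdot>\<^sub>v (\<rho> (s \<otimes> t) *\<^sub>v x)"
      by simp
  qed (use assms car in \<open>auto simp: subgroup.m_closed subgroup.m_inv_closed simp flip: m_assoc\<close>)
  also have "\<dots> = \<psi> s \<cdot>\<^sub>v average T \<psi> x"
    using assms car by (simp add: average_def flip: smult_smult_assoc vsum_smult_right)
  finally show ?thesis .
qed

lemma average_eigenvector:
  assumes T: "subgroup T G" "mult_char G T \<psi>" "mult_char G T \<eta>"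
    and x: "x \<in> carrier_vec n" "\<And>t. t \<in> T \<Longrightarrow> \<rho> t *\<^sub>v x = \<eta> t \<cdot>\<^sub>v x"
  shows "average T \<psi> x = (if \<forall>t\<in>T. \<eta> t = \<psi> t then of_nat (card T) \<cdot>\<^sub>v x else 0\<^sub>v n)"
proof -
  have "average T \<psi> x = (\<Sum>t\<in>T. cnj (\<psi> t) * \<eta> t) \<cdot>\<^sub>v x"
    using x by (simp add: average_def smult_smult_assoc vsum_smult_left cong: vsum_cong)
  moreover have "mult_char G T (\<lambda>t. cnj (\<psi> t) * \<eta> t)"
    using T by (simp add: mult_char_def)
  moreover have "cnj (\<psi> t) * \<eta> t = 1 \<longleftrightarrow> \<eta> t = \<psi> t" if "t \<in> T" for t
    using mult_char_cnj[OF fin T(1,2) that] by (metis mult.left_commute mult.right_neutral)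
  ultimately show ?thesis
    using x(1) by (auto simp: sum_mult_char[OF T(1)])
qed

lemma average_smult:
  assumes "T \<subseteq> carrier G" "x \<in> carrier_vec n"
  shows "average T \<psi> (c \<cdot>\<^sub>v x) = c \<cdot>\<^sub>v average T \<psi> x"
proof -
  have "average T \<psi> (c \<cdot>\<^sub>v x) = vsum n T (\<lambda>t. c \<cdot>\<^sub>v (cnj (\<psi> t) \<cdot>\<^sub>v (\<rho> t *\<^sub>v x)))"
    unfolding average_def
    by (rule vsum_cong) (use assms in \<open>auto simp: subset_iff smult_smult_assoc mult.commute\<close>)
  also have "\<dots> = c \<cdot>\<^sub>v average T \<psi> x"
    unfolding average_def
    by (rule vsum_smult_right) (use assms in \<open>auto simp: subset_iff\<close>)
  finally show ?thesis .
qed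

lemma average_vsum:
  assumes "T \<subseteq> carrier G" "\<And>s. s \<in> S \<Longrightarrow> f s \<in> carrier_vec n"
  shows "average T \<psi> (vsum n S f) = vsum n S (\<lambda>s. average T \<psi> (f s))"
proof -
  have "average T \<psi> (vsum n S f) = vsum n T (\<lambda>t. vsum n S (\<lambda>s. cnj (\<psi> t) \<cdot>\<^sub>v (\<rho> t *\<^sub>v f s)))"
    unfolding average_def
    by (rule vsum_cong) (use assms in \<open>auto simp: subset_iff mult_mat_vsum vsum_smult_right\<close>)
  then show ?thesis by (simp add: average_def vsum_swap[of n T])
qed

text \<open>
  A common eigenvector turns the group law into multiplication of eigenvalues. This gives
  linear characters without any check that a formula for them is well defined.
\<close>

lemma eigenvalues_mult_char:
  assumes T: "subgroup T G" and w: "w \<in> carrier_vec n" "w \<noteq> 0\<^sub>v n"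
    and ev: "\<And>t. t \<in> T \<Longrightarrow> \<exists>c. \<rho> t *\<^sub>v w = c \<cdot>\<^sub>v w"
  obtains \<psi> where "mult_char G T \<psi>" "\<And>t. t \<in> T \<Longrightarrow> \<rho> t *\<^sub>v w = \<psi> t \<cdot>\<^sub>v w"
proof -
  obtain \<psi> where \<psi>: "\<And>t. t \<in> T \<Longrightarrow> \<rho> t *\<^sub>v w = \<psi> t \<cdot>\<^sub>v w" using ev by metis
  have car: "t \<in> carrier G" if "t \<in> T" for t by (rule subgroup.mem_carrier[OF T that])
  have "\<psi> \<one> = 1"
    using \<psi>[of \<one>] w subgroup.one_closed[OF T] by (intro smult_vec_cancel[OF w]) simp
  moreover have "\<psi> (s \<otimes> t) = \<psi> s * \<psi> t" if "s \<in> T" "t \<in> T" for s t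
  proof (rule smult_vec_cancel[OF w])
    have "\<psi> (s \<otimes> t) \<cdot>\<^sub>v w = \<rho> s *\<^sub>v (\<rho> t *\<^sub>v w)"
      using \<psi>[of "s \<otimes> t"] that w car subgroup.m_closed[OF T] by (simp add: rep_mult)
    then show "\<psi> (s \<otimes> t) \<cdot>\<^sub>v w = (\<psi> s * \<psi> t) \<cdot>\<^sub>v w"
      using \<psi> that w car by (simp add: smult_smult_assoc mult.commute)
  qed
  ultimately show thesis using that[of \<psi>] \<psi> by (auto simp: mult_char_def)
qed

end

section \<open>Common eigenvectors of abelian subgroups\<close>

text \<open>
  There are fewer \<open>i\<close>-th than \<open>m\<close>-th roots of unity, so some \<open>m\<close>-th root of unity \<open>w\<close> has
  \<open>w ^ i \<noteq> 1\<close>; multiplication by \<open>w\<close> permutes the summation range and scales the sum by \<open>w ^ i\<close>.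
\<close>

lemma sum_roots_of_unity_power:
  assumes "0 < i" "i < m"
  shows "(\<Sum>z | z ^ m = (1::complex). z ^ i) = 0"
proof -
  let ?Z = "\<lambda>k. {z::complex. z ^ k = 1}"
  have "card (?Z i) < card (?Z m)" using assms by (simp add: card_roots_unity_eq)
  then have "\<not> ?Z m \<subseteq> ?Z i"
    using card_mono[OF finite_roots_unity[of i], of "?Z m"] assms by auto
  then obtain w :: complex where w: "w ^ m = 1" "w ^ i \<noteq> 1" by blast
  then have "w \<noteq> 0" using assms by (auto simp: power_0_left)
  then have "(\<Sum>z\<in>?Z m. z ^ i) = (\<Sum>z\<in>?Z m. (w * z) ^ i)"
    by (intro sum.reindex_bij_witness[of _ "\<lambda>z. w * z" "\<lambda>z. z / w"])
       (use w in \<open>auto simp: power_mult_distrib power_divide\<close>)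
  also have "\<dots> = w ^ i * (\<Sum>z\<in>?Z m. z ^ i)"
    by (simp add: power_mult_distrib sum_distrib_left)
  finally show ?thesis using w(2) by simp
qed

context finite_group_rep
begin

text \<open>
  With \<open>m\<close> the order of the group, the vectors \<open>y z\<close> of the proof, one for each \<open>m\<close>-th root
  of unity \<open>z\<close>, are eigenvectors of \<open>b\<close> or zero, and they add up to \<open>m\<close> times \<open>w\<close>; hence one of
  them is nonzero. The eigenvector is given explicitly as a combination of the translates of
  \<open>w\<close> by powers of \<open>b\<close>, so that operators commuting with \<open>b\<close> can be moved past it.
\<close>

lemma cyclic_eigenvector:
  assumes b: "b \<in> carrier G" and w: "w \<in> carrier_vec n" "w \<noteq> 0\<^sub>v n"
  obtains f z where "vsum n {..<Coset.order G} (\<lambda>i. f i \<cdot>\<^sub>v (\<rho> (b [^] i) *\<^sub>v w)) \<noteq> 0\<^sub>v n"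
    and "\<rho> b *\<^sub>v vsum n {..<Coset.order G} (\<lambda>i. f i \<cdot>\<^sub>v (\<rho> (b [^] i) *\<^sub>v w)) =
           z \<cdot>\<^sub>v vsum n {..<Coset.order G} (\<lambda>i. f i \<cdot>\<^sub>v (\<rho> (b [^] i) *\<^sub>v w))"
proof -
  define m where "m = Coset.order G"
  have m: "m > 0" using fin order_gt_0_iff_finite by (simp add: m_def)
  define y where "y z = vsum n {..<m} (\<lambda>i. z ^ i \<cdot>\<^sub>v (\<rho> (b [^] i) *\<^sub>v w))" for z
  have step: "z \<cdot>\<^sub>v (\<rho> b *\<^sub>v y z) = y z" if z: "z ^ m = 1" for z
  proof -
    let ?g = "\<lambda>i. z ^ i \<cdot>\<^sub>v (\<rho> (b [^] i) *\<^sub>v w)"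
    have "z \<cdot>\<^sub>v (\<rho> b *\<^sub>v y z) = vsum n {..<m} (\<lambda>i. z \<cdot>\<^sub>v (\<rho> b *\<^sub>v ?g i))"
      using b w by (simp add: y_def mult_mat_vsum vsum_smult_right)
    also have "\<dots> = vsum n {..<m} (\<lambda>i. ?g (Suc i))"
    proof (rule vsum_cong)
      fix i
      have "\<rho> (b [^] Suc i) *\<^sub>v w = \<rho> b *\<^sub>v (\<rho> (b [^] i) *\<^sub>v w)"
        using rep_mult[of b "b [^] i" w] nat_pow_Suc2[OF b, of i] b w by (simp del: nat_pow_Suc)
      then show "z \<cdot>\<^sub>v (\<rho> b *\<^sub>v ?g i) = ?g (Suc i)"
        using b w by (simp add: smult_smult_assoc del: nat_pow_Suc)
    qed
    also have "\<dots> = vsum n {..<m} ?g"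
    proof -
      have "?g m = ?g 0" using z b w pow_order_eq_1[OF b] by (simp add: m_def)
      then have "(\<Sum>i<m. ?g (Suc i) $ k) = (\<Sum>i<m. ?g i $ k)" for k
        using sum.lessThan_Suc_shift[of "\<lambda>i. ?g i $ k" m] sum.lessThan_Suc[of "\<lambda>i. ?g i $ k" m]
        by simp
      then show ?thesis unfolding vsum_def by simp
    qed
    finally show ?thesis by (simp add: y_def)
  qed
  have "\<exists>z. z ^ m = 1 \<and> y z \<noteq> 0\<^sub>v n"
  proof (rule ccontr)
    assume "\<not> ?thesis"
    then have "vsum n {z. z ^ m = 1} y = 0\<^sub>v n" by (intro vsum_zero) auto
    moreover have "vsum n {z. z ^ m = 1} y = of_nat m \<cdot>\<^sub>v w"
    proof -
      have "vsum n {z. z ^ m = 1} y =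
          vsum n {..<m} (\<lambda>i. (\<Sum>z | z ^ m = 1. z ^ i) \<cdot>\<^sub>v (\<rho> (b [^] i) *\<^sub>v w))"
      proof -
        have "y = (\<lambda>z. vsum n {..<m} (\<lambda>i. z ^ i \<cdot>\<^sub>v (\<rho> (b [^] i) *\<^sub>v w)))"
          by (rule ext) (rule y_def)
        then show ?thesis
          using b w by (simp add: vsum_swap[of n "{z. z ^ m = 1}"] vsum_smult_left)
      qed
      also have "\<dots> = vsum n {..<m} (\<lambda>i. if i = 0 then of_nat m \<cdot>\<^sub>v w else 0\<^sub>v n)"
        using b w m
        by (intro vsum_cong) (auto simp: sum_roots_of_unity_power card_roots_unity_eq zero_smult_vec)
      also have "\<dots> = of_nat m \<cdot>\<^sub>v w"
        using m w by (intro eq_vecI) (auto simp: vsum_def if_distrib[of "\<lambda>u. u $ _"] cong: if_cong)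
      finally show ?thesis .
    qed
    ultimately show False using smult_vec_nonzero[OF w, of "of_nat m"] m by simp
  qed
  then obtain z where z: "z ^ m = 1" "y z \<noteq> 0\<^sub>v n" by blast
  then have "z \<noteq> 0" using m by (auto simp: power_0_left)
  then have "\<rho> b *\<^sub>v y z = inverse z \<cdot>\<^sub>v (z \<cdot>\<^sub>v (\<rho> b *\<^sub>v y z))"
    by (simp add: smult_smult_assoc)
  then have "\<rho> b *\<^sub>v y z = inverse z \<cdot>\<^sub>v y z" by (simp only: step[OF z(1)])
  then show thesis using that[of "\<lambda>i. z ^ i" "inverse z"] z(2) by (simp add: y_def m_def)
qed

text \<open>
  Elements of \<open>A\<close> are made to act by scalars one after the other: \<open>cyclic_eigenvector\<close> handles
  the next element, and commutativity preserves the eigenvalues found before. Every vector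
  produced is a combination of \<open>A\<close>-translates of \<open>v\<close>, so an average that kills \<open>v\<close> kills it as
  well. The common eigenvector \<open>w\<close> obtained in the end is not killed by the average against
  its own eigenvalues \<open>\<mu>\<close>, and therefore neither is \<open>v\<close>.
\<close>

lemma abelian_average_nonzero:
  assumes A: "subgroup A G" and comm: "\<And>a b. a \<in> A \<Longrightarrow> b \<in> A \<Longrightarrow> a \<otimes> b = b \<otimes> a"
    and v: "v \<in> carrier_vec n" "v \<noteq> 0\<^sub>v n"
  obtains \<mu> where "mult_char G A \<mu>" "average A \<mu> v \<noteq> 0\<^sub>v n"
proof -
  have car: "a \<in> carrier G" if "a \<in> A" for a by (rule subgroup.mem_carrier[OF A that])
  have sub: "A \<subseteq> carrier G" using car by blast
  have "\<exists>w\<in>carrier_vec n. w \<noteq> 0\<^sub>v n \<and> (\<forall>b\<in>B. \<exists>z. \<rho> b *\<^sub>v w = z \<cdot>\<^sub>v w) \<and>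
      (\<forall>\<mu>. mult_char G A \<mu> \<longrightarrow> average A \<mu> v = 0\<^sub>v n \<longrightarrow> average A \<mu> w = 0\<^sub>v n)"
    if "finite B" "B \<subseteq> A" for B
    using that
  proof (induction B rule: finite_induct)
    case empty
    then show ?case using v by auto
  next
    case (insert b B)
    then obtain w where w: "w \<in> carrier_vec n" "w \<noteq> 0\<^sub>v n"
      and ev: "\<And>c. c \<in> B \<Longrightarrow> \<exists>z. \<rho> c *\<^sub>v w = z \<cdot>\<^sub>v w"
      and kill: "\<And>\<mu>. mult_char G A \<mu> \<Longrightarrow> average A \<mu> v = 0\<^sub>v n \<Longrightarrow> average A \<mu> w = 0\<^sub>v n"
      by auto
    have b: "b \<in> A" "b \<in> carrier G" using insert.prems car by auto
    have powA: "b [^] i \<in> A" for i :: nat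
      by (induction i) (use b A in \<open>auto simp: subgroup.one_closed subgroup.m_closed\<close>)
    obtain f z where fz: "vsum n {..<Coset.order G} (\<lambda>i. f i \<cdot>\<^sub>v (\<rho> (b [^] i) *\<^sub>v w)) \<noteq> 0\<^sub>v n"
      "\<rho> b *\<^sub>v vsum n {..<Coset.order G} (\<lambda>i. f i \<cdot>\<^sub>v (\<rho> (b [^] i) *\<^sub>v w)) =
         z \<cdot>\<^sub>v vsum n {..<Coset.order G} (\<lambda>i. f i \<cdot>\<^sub>v (\<rho> (b [^] i) *\<^sub>v w))"
      using cyclic_eigenvector[OF b(2) w] by blast
    define y where "y = vsum n {..<Coset.order G} (\<lambda>i. f i \<cdot>\<^sub>v (\<rho> (b [^] i) *\<^sub>v w))"
    have "\<exists>z. \<rho> c *\<^sub>v y = z \<cdot>\<^sub>v y" if c: "c \<in> B" for c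
    proof -
      have cA: "c \<in> A" "c \<in> carrier G" using c insert.prems car by auto
      obtain z where z: "\<rho> c *\<^sub>v w = z \<cdot>\<^sub>v w" using ev[OF c] by blast
      have *: "\<rho> c *\<^sub>v (\<rho> (b [^] i) *\<^sub>v w) = z \<cdot>\<^sub>v (\<rho> (b [^] i) *\<^sub>v w)" for i :: nat
        using rep_mult[OF cA(2), of "b [^] i" w] rep_mult[OF _ cA(2), of "b [^] i" w]
          comm[OF cA(1) powA[of i]] b w z by simp
      have "\<rho> c *\<^sub>v y = vsum n {..<Coset.order G} (\<lambda>i. z \<cdot>\<^sub>v (f i \<cdot>\<^sub>v (\<rho> (b [^] i) *\<^sub>v w)))"
        using b cA w * by (simp add: y_def mult_mat_vsum smult_smult_assoc mult.commute)
      also have "\<dots> = z \<cdot>\<^sub>v y" using b w by (simp add: y_def vsum_smult_right)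
      finally show ?thesis by blast
    qed
    moreover have "average A \<mu> y = 0\<^sub>v n" if \<mu>: "mult_char G A \<mu>" "average A \<mu> v = 0\<^sub>v n" for \<mu>
    proof -
      have "average A \<mu> (f i \<cdot>\<^sub>v (\<rho> (b [^] i) *\<^sub>v w)) = 0\<^sub>v n" for i :: nat
        using average_rep[OF A \<mu>(1) powA[of i] w(1)] kill[OF \<mu>] b w sub
        by (simp add: average_smult smult_zero_vec)
      then show ?thesis using b w sub by (simp add: y_def average_vsum vsum_zero)
    qed
    moreover have "y \<noteq> 0\<^sub>v n" "\<rho> b *\<^sub>v y = z \<cdot>\<^sub>v y" "y \<in> carrier_vec n"
      using fz by (simp_all add: y_def)
    ultimately show ?case by blast
  qed
  from this[OF finite_subset[OF sub fin] subset_refl]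
  obtain w where w: "w \<in> carrier_vec n" "w \<noteq> 0\<^sub>v n"
    and ev: "\<And>a. a \<in> A \<Longrightarrow> \<exists>z. \<rho> a *\<^sub>v w = z \<cdot>\<^sub>v w"
    and kill: "\<And>\<mu>. mult_char G A \<mu> \<Longrightarrow> average A \<mu> v = 0\<^sub>v n \<Longrightarrow> average A \<mu> w = 0\<^sub>v n"
    by blast
  obtain \<mu> where \<mu>: "mult_char G A \<mu>" "\<And>a. a \<in> A \<Longrightarrow> \<rho> a *\<^sub>v w = \<mu> a \<cdot>\<^sub>v w"
    using eigenvalues_mult_char[OF A w ev] by blast
  have "card A \<noteq> 0"
    using subgroup.one_closed[OF A] finite_subset[OF sub fin] by auto
  then have "average A \<mu> w \<noteq> 0\<^sub>v n"
    using average_eigenvector[OF A \<mu>(1,1) w(1) \<mu>(2)] smult_vec_nonzero[OF w] by simp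
  then show thesis using that \<mu>(1) kill by blast
qed

end

section \<open>Constituents of characters induced from linear characters\<close>

context finite_group_rep
begin

lemma mat_trace_conj:
  assumes "x \<in> carrier G" "t \<in> carrier G"
  shows "mat_trace (\<rho> (x \<otimes> t \<otimes> inv x)) = mat_trace (\<rho> t)"
proof -
  have mult: "\<rho> (g \<otimes> h) = \<rho> g * \<rho> h" if "g \<in> carrier G" "h \<in> carrier G" for g h
    using rep that by (simp add: representation_def)
  have "mat_trace (\<rho> (x \<otimes> t \<otimes> inv x)) = mat_trace (\<rho> (inv x) * \<rho> (x \<otimes> t))"
    using assms by (simp add: mult[of "x \<otimes> t"] mat_trace_commute[of _ n])
  also have "\<dots> = mat_trace (\<rho> t)"
    using assms by (simp flip: mult m_assoc)
  finally show ?thesis .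
qed

text \<open>
  Frobenius reciprocity: exchange the two summations and use that a character is constant on
  conjugacy classes, so that each \<open>x\<close> contributes the same sum over \<open>T\<close>.
\<close>

lemma char_inner_induced:
  assumes T: "subgroup T G"
  shows "char_inner G (afforded_char G \<rho>) (induced_char G T \<psi>) =
    (\<Sum>t\<in>T. mat_trace (\<rho> t) * cnj (\<psi> t)) / of_nat (card T)"
proof -
  let ?tr = "\<lambda>g. mat_trace (\<rho> g)" and ?c = "of_nat (card T) :: complex"
  have car: "t \<in> carrier G" if "t \<in> T" for t by (rule subgroup.mem_carrier[OF T that])
  have conj: "inv x \<otimes> (x \<otimes> t \<otimes> inv x) \<otimes> x = t" "x \<otimes> (inv x \<otimes> t \<otimes> x) \<otimes> inv x = t"
    if "x \<in> carrier G" "t \<in> carrier G" for x t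
  proof -
    have "inv x \<otimes> (x \<otimes> t \<otimes> inv x) \<otimes> x = (inv x \<otimes> x) \<otimes> t \<otimes> (inv x \<otimes> x)"
      using that by (simp only: m_assoc inv_closed m_closed)
    then show "inv x \<otimes> (x \<otimes> t \<otimes> inv x) \<otimes> x = t" using that by simp
    have "x \<otimes> (inv x \<otimes> t \<otimes> x) \<otimes> inv x = (x \<otimes> inv x) \<otimes> t \<otimes> (x \<otimes> inv x)"
      using that by (simp only: m_assoc inv_closed m_closed)
    then show "x \<otimes> (inv x \<otimes> t \<otimes> x) \<otimes> inv x = t" using that by simp
  qed
  have "(\<Sum>g\<in>carrier G. afforded_char G \<rho> g * cnj (induced_char G T \<psi> g)) =
      (\<Sum>g\<in>carrier G. \<Sum>x | x \<in> carrier G \<and> inv x \<otimes> g \<otimes> x \<in> T.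
         ?tr g * cnj (\<psi> (inv x \<otimes> g \<otimes> x)) / ?c)"
    by (simp add: afforded_char_def induced_char_def sum_distrib_left sum_divide_distrib cong: sum.cong)
  also have "\<dots> = (\<Sum>x\<in>carrier G. \<Sum>g | g \<in> carrier G \<and> inv x \<otimes> g \<otimes> x \<in> T.
         ?tr g * cnj (\<psi> (inv x \<otimes> g \<otimes> x)) / ?c)"
    by (rule sum.swap_restrict) auto
  also have "\<dots> = (\<Sum>x\<in>carrier G. \<Sum>t\<in>T. ?tr t * cnj (\<psi> t) / ?c)"
  proof (rule sum.cong[OF refl])
    fix x assume x: "x \<in> carrier G"
    show "(\<Sum>g | g \<in> carrier G \<and> inv x \<otimes> g \<otimes> x \<in> T. ?tr g * cnj (\<psi> (inv x \<otimes> g \<otimes> x)) / ?c) =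
        (\<Sum>t\<in>T. ?tr t * cnj (\<psi> t) / ?c)"
    proof (rule sum.reindex_bij_witness[of _ "\<lambda>t. x \<otimes> t \<otimes> inv x" "\<lambda>g. inv x \<otimes> g \<otimes> x"])
      fix g assume g: "g \<in> {g. g \<in> carrier G \<and> inv x \<otimes> g \<otimes> x \<in> T}"
      then have "?tr (inv x \<otimes> g \<otimes> x) = ?tr g"
        using x mat_trace_conj[of "inv x" g] by simp
      then show "?tr (inv x \<otimes> g \<otimes> x) * cnj (\<psi> (inv x \<otimes> g \<otimes> x)) / ?c =
          ?tr g * cnj (\<psi> (inv x \<otimes> g \<otimes> x)) / ?c" by simp
    qed (use x car conj in auto)
  qed
  also have "\<dots> = of_nat (card (carrier G)) * ((\<Sum>t\<in>T. ?tr t * cnj (\<psi> t)) / ?c)"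
    by (simp add: sum_divide_distrib)
  finally show ?thesis
    using fin one_closed by (auto simp: char_inner_def)
qed

text \<open>
  The right-hand side of Frobenius reciprocity is the trace of the normalised average \<open>P\<close>, an
  idempotent whose fixed vectors are the \<open>\<psi>\<close>-eigenvectors.
\<close>

lemma char_inner_induced_pos_iff:
  assumes T: "subgroup T G" "mult_char G T \<psi>"
  shows "0 < char_inner G (afforded_char G \<rho>) (induced_char G T \<psi>) \<longleftrightarrow>
    (\<exists>x \<in> carrier_vec n. x \<noteq> 0\<^sub>v n \<and> (\<forall>t\<in>T. \<rho> t *\<^sub>v x = \<psi> t \<cdot>\<^sub>v x))"
proof -
  let ?c = "of_nat (card T) :: complex"
  have car: "t \<in> carrier G" if "t \<in> T" for t by (rule subgroup.mem_carrier[OF T(1) that])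
  have sub: "T \<subseteq> carrier G" using car by blast
  have c: "?c \<noteq> 0"
    using subgroup.one_closed[OF T(1)] finite_subset[OF sub fin] by auto
  define P where "P = mat n n (\<lambda>(i, j). (\<Sum>t\<in>T. \<rho> t $$ (i, j) * cnj (\<psi> t)) / ?c)"
  have P: "P \<in> carrier_mat n n" by (simp add: P_def)
  have dim: "dim_row (\<rho> t) = n" "dim_col (\<rho> t) = n" if "t \<in> T" for t
    using rep_carrier[OF car[OF that]] by auto
  have tr: "char_inner G (afforded_char G \<rho>) (induced_char G T \<psi>) = mat_trace P"
  proof -
    have "(\<Sum>t\<in>T. mat_trace (\<rho> t) * cnj (\<psi> t)) = (\<Sum>t\<in>T. \<Sum>i<n. \<rho> t $$ (i, i) * cnj (\<psi> t))"
      using car by (intro sum.cong) (auto simp: mat_trace_eq[OF rep_carrier] sum_distrib_right)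
    also have "\<dots> = (\<Sum>i<n. \<Sum>t\<in>T. \<rho> t $$ (i, i) * cnj (\<psi> t))"
      by (rule sum.swap)
    finally have "char_inner G (afforded_char G \<rho>) (induced_char G T \<psi>) =
        (\<Sum>i<n. (\<Sum>t\<in>T. \<rho> t $$ (i, i) * cnj (\<psi> t)) / ?c)"
      by (simp only: char_inner_induced[OF T(1)] sum_divide_distrib)
    also have "\<dots> = (\<Sum>i<n. P $$ (i, i))" by (simp add: P_def)
    finally show ?thesis by (simp only: mat_trace_eq[OF P])
  qed
  have Px: "P *\<^sub>v x = inverse ?c \<cdot>\<^sub>v average T \<psi> x" if x: "x \<in> carrier_vec n" for x
  proof (rule eq_vecI)
    fix i assume "i < dim_vec (inverse ?c \<cdot>\<^sub>v average T \<psi> x)"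
    then have i: "i < n" by (simp add: average_def)
    have "(P *\<^sub>v x) $ i = (\<Sum>j<n. (\<Sum>t\<in>T. \<rho> t $$ (i, j) * cnj (\<psi> t)) / ?c * x $ j)"
      using i x by (simp add: P_def scalar_prod_def atLeast0LessThan)
    also have "\<dots> = (\<Sum>j<n. \<Sum>t\<in>T. \<rho> t $$ (i, j) * cnj (\<psi> t) / ?c * x $ j)"
      by (simp add: sum_divide_distrib sum_distrib_right)
    also have "\<dots> = (\<Sum>t\<in>T. \<Sum>j<n. \<rho> t $$ (i, j) * cnj (\<psi> t) / ?c * x $ j)"
      by (rule sum.swap)
    also have "\<dots> = (\<Sum>t\<in>T. inverse ?c * (cnj (\<psi> t) * (\<Sum>j<n. \<rho> t $$ (i, j) * x $ j)))"
      by (simp add: sum_distrib_left field_simps)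
    also have "\<dots> = (\<Sum>t\<in>T. inverse ?c * (cnj (\<psi> t) \<cdot>\<^sub>v (\<rho> t *\<^sub>v x)) $ i)"
      using i x dim by (intro sum.cong) (auto simp: scalar_prod_def atLeast0LessThan)
    also have "\<dots> = (inverse ?c \<cdot>\<^sub>v average T \<psi> x) $ i"
      using i by (simp add: average_def vsum_def sum_distrib_left)
    finally show "(P *\<^sub>v x) $ i = (inverse ?c \<cdot>\<^sub>v average T \<psi> x) $ i" .
  qed (use P in \<open>simp add: average_def\<close>)
  have fixed: "P *\<^sub>v x = x \<longleftrightarrow> (\<forall>t\<in>T. \<rho> t *\<^sub>v x = \<psi> t \<cdot>\<^sub>v x)" if x: "x \<in> carrier_vec n" for x
  proof
    assume "P *\<^sub>v x = x"
    then have eq: "x = inverse ?c \<cdot>\<^sub>v average T \<psi> x" using Px[OF x] by simp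
    have "\<rho> t *\<^sub>v (inverse ?c \<cdot>\<^sub>v average T \<psi> x) = \<psi> t \<cdot>\<^sub>v (inverse ?c \<cdot>\<^sub>v average T \<psi> x)"
      if "t \<in> T" for t
      using rep_average[OF T that x] car[OF that] by (simp add: smult_smult_assoc mult.commute)
    then show "\<forall>t\<in>T. \<rho> t *\<^sub>v x = \<psi> t \<cdot>\<^sub>v x" by (simp flip: eq)
  next
    assume "\<forall>t\<in>T. \<rho> t *\<^sub>v x = \<psi> t \<cdot>\<^sub>v x"
    then show "P *\<^sub>v x = x"
      using average_eigenvector[OF T T(2) x] Px[OF x] c x by (simp add: smult_smult_assoc)
  qed
  have "P *\<^sub>v (P *\<^sub>v x) = P *\<^sub>v x" if x: "x \<in> carrier_vec n" for x
  proof -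
    have "\<rho> t *\<^sub>v (P *\<^sub>v x) = \<psi> t \<cdot>\<^sub>v (P *\<^sub>v x)" if "t \<in> T" for t
      using rep_average[OF T that x] car[OF that]
      by (simp add: Px[OF x] smult_smult_assoc mult.commute)
    then show ?thesis using fixed[of "P *\<^sub>v x"] P x by simp
  qed
  then show ?thesis
    using mat_trace_idempotent_pos_iff[OF P] fixed by (auto simp: tr)
qed

end

section \<open>Enlarging a linear character to contain an abelian normal subgroup\<close>

lemma (in group) mult_char_conj_invariant:
  assumes "subgroup T G" "mult_char G T \<psi>" "h \<in> T" "a \<in> T"
  shows "\<psi> (inv h \<otimes> a \<otimes> h) = \<psi> a"
proof -
  have h: "inv h \<in> T" "h \<in> carrier G"
    using assms(1,3) by (auto simp: subgroup.m_inv_closed subgroup.mem_carrier)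
  have "\<psi> (inv h \<otimes> a \<otimes> h) = (\<psi> (inv h) * \<psi> h) * \<psi> a"
    using assms h by (simp add: mult_char_def subgroup.m_closed)
  also have "\<psi> (inv h \<otimes> h) = \<psi> (inv h) * \<psi> h"
    using assms(2,3) h(1) unfolding mult_char_def by blast
  then have "\<psi> (inv h) * \<psi> h = 1" using assms(2) h by (simp add: mult_char_def)
  finally show ?thesis by simp
qed

lemma (in group) mult_char_conj:
  assumes "A \<lhd> G" "mult_char G A \<mu>" "h \<in> carrier G"
  shows "mult_char G A (\<lambda>a. \<mu> (inv h \<otimes> a \<otimes> h))"
  unfolding mult_char_def
proof (intro conjI ballI)
  have A: "subgroup A G" by (rule normal_imp_subgroup[OF assms(1)])
  show "\<mu> (inv h \<otimes> \<one> \<otimes> h) = 1" using assms by (simp add: mult_char_def)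
  fix s t assume st: "s \<in> A" "t \<in> A"
  then have car: "s \<in> carrier G" "t \<in> carrier G" using A by (auto simp: subgroup.mem_carrier)
  have "(inv h \<otimes> s \<otimes> h) \<otimes> (inv h \<otimes> t \<otimes> h) = inv h \<otimes> s \<otimes> (h \<otimes> inv h) \<otimes> t \<otimes> h"
    using car assms(3) by (simp only: m_assoc m_closed inv_closed)
  also have "\<dots> = inv h \<otimes> (s \<otimes> t) \<otimes> h" using car assms(3) by (simp add: m_assoc)
  finally have "inv h \<otimes> (s \<otimes> t) \<otimes> h = (inv h \<otimes> s \<otimes> h) \<otimes> (inv h \<otimes> t \<otimes> h)" ..
  then show "\<mu> (inv h \<otimes> (s \<otimes> t) \<otimes> h) = \<mu> (inv h \<otimes> s \<otimes> h) * \<mu> (inv h \<otimes> t \<otimes> h)"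
    using assms(2) normal.inv_op_closed1[OF assms(1,3)] st by (simp add: mult_char_def)
qed

context finite_group_rep
begin

lemma rep_average_conj:
  assumes A: "A \<lhd> G" and h: "h \<in> carrier G" and x: "x \<in> carrier_vec n"
  shows "\<rho> h *\<^sub>v average A \<mu> x = average A (\<lambda>a. \<mu> (inv h \<otimes> a \<otimes> h)) (\<rho> h *\<^sub>v x)"
proof -
  have car: "a \<in> carrier G" if "a \<in> A" for a
    by (rule subgroup.mem_carrier[OF normal_imp_subgroup[OF A] that])
  have "\<rho> h *\<^sub>v average A \<mu> x = vsum n A (\<lambda>a. cnj (\<mu> a) \<cdot>\<^sub>v (\<rho> h *\<^sub>v (\<rho> a *\<^sub>v x)))"
    using h x car by (simp add: average_def mult_mat_vsum cong: vsum_cong)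
  also have "\<dots> = average A (\<lambda>a. \<mu> (inv h \<otimes> a \<otimes> h)) (\<rho> h *\<^sub>v x)"
    unfolding average_def
  proof (rule vsum_reindex_bij_witness[of _ "\<lambda>a. inv h \<otimes> a \<otimes> h" "\<lambda>a. h \<otimes> a \<otimes> inv h"])
    have cancel_left: "h \<otimes> (inv h \<otimes> g) = g" "inv h \<otimes> (h \<otimes> g) = g" if "g \<in> carrier G" for g
      using h that by (simp_all flip: m_assoc)
    have cancel: "inv h \<otimes> (h \<otimes> a \<otimes> inv h) \<otimes> h = a" "h \<otimes> (inv h \<otimes> a \<otimes> h) \<otimes> inv h = a"
      "(h \<otimes> a \<otimes> inv h) \<otimes> h = h \<otimes> a"
      if "a \<in> A" for a
      using h car[OF that] by (simp_all add: m_assoc cancel_left)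
    fix a assume a: "a \<in> A"
    show "inv h \<otimes> (h \<otimes> a \<otimes> inv h) \<otimes> h = a" "h \<otimes> (inv h \<otimes> a \<otimes> h) \<otimes> inv h = a"
      by (rule cancel[OF a])+
    show "h \<otimes> a \<otimes> inv h \<in> A" by (rule normal.inv_op_closed2[OF A h a])
    show "inv h \<otimes> a \<otimes> h \<in> A" by (rule normal.inv_op_closed1[OF A h a])
    have "\<rho> (h \<otimes> a \<otimes> inv h) *\<^sub>v (\<rho> h *\<^sub>v x) = \<rho> h *\<^sub>v (\<rho> a *\<^sub>v x)"
      using h x car[OF a] cancel(3)[OF a] by (simp flip: rep_mult)
    then show "cnj (\<mu> (inv h \<otimes> (h \<otimes> a \<otimes> inv h) \<otimes> h)) \<cdot>\<^sub>v (\<rho> (h \<otimes> a \<otimes> inv h) *\<^sub>v (\<rho> h *\<^sub>v x)) =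
        cnj (\<mu> a) \<cdot>\<^sub>v (\<rho> h *\<^sub>v (\<rho> a *\<^sub>v x))"
      by (simp only: cancel(1)[OF a])
  qed
  finally show ?thesis .
qed

text \<open>
  The subgroup \<open>T\<close> is the product of \<open>A\<close> with \<open>S\<close>, the elements of \<open>H\<close> that act through \<open>\<mu>\<close> on
  the projection \<open>w\<close> of \<open>v\<close> to an eigenspace of \<open>A\<close>. By the last two properties, \<open>H\<close> meets \<open>T\<close>
  exactly in the stabiliser of the restriction of \<open>\<psi>\<close> to \<open>A\<close>, and \<open>\<psi>\<close> agrees with \<open>\<mu>\<close>
  there. They do not mention the representation, and so can be used in any other one.
\<close>

lemma enlarge_linear_character:
  assumes A: "A \<lhd> G" and comm: "\<And>a b. a \<in> A \<Longrightarrow> b \<in> A \<Longrightarrow> a \<otimes> b = b \<otimes> a"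
    and H: "subgroup H G" "mult_char G H \<mu>"
    and v: "v \<in> carrier_vec n" "v \<noteq> 0\<^sub>v n" "\<And>h. h \<in> H \<Longrightarrow> \<rho> h *\<^sub>v v = \<mu> h \<cdot>\<^sub>v v"
  obtains T \<psi> w where "subgroup T G" "A \<subseteq> T" "mult_char G T \<psi>"
    and "w \<in> carrier_vec n" "w \<noteq> 0\<^sub>v n" "\<And>t. t \<in> T \<Longrightarrow> \<rho> t *\<^sub>v w = \<psi> t \<cdot>\<^sub>v w"
    and "\<And>h. h \<in> H \<Longrightarrow> h \<in> T \<Longrightarrow> \<psi> h = \<mu> h"
    and "\<And>h. h \<in> H \<Longrightarrow> h \<notin> T \<Longrightarrow> \<exists>a\<in>A. \<psi> (inv h \<otimes> a \<otimes> h) \<noteq> \<psi> a"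
proof -
  have subA: "subgroup A G" by (rule normal_imp_subgroup[OF A])
  have carA: "a \<in> carrier G" if "a \<in> A" for a by (rule subgroup.mem_carrier[OF subA that])
  have carH: "h \<in> carrier G" if "h \<in> H" for h by (rule subgroup.mem_carrier[OF H(1) that])
  obtain \<nu> where \<nu>: "mult_char G A \<nu>" and w_nz: "average A \<nu> v \<noteq> 0\<^sub>v n"
    using abelian_average_nonzero[OF subA comm v(1,2)] by blast
  define w where "w = average A \<nu> v"
  have w: "w \<in> carrier_vec n" "w \<noteq> 0\<^sub>v n" using w_nz by (simp_all add: w_def)
  have wA: "\<rho> a *\<^sub>v w = \<nu> a \<cdot>\<^sub>v w" if "a \<in> A" for a
    unfolding w_def by (rule rep_average[OF subA \<nu> that v(1)])
  \<comment> \<open>an element of \<open>H\<close> fixing \<open>\<nu>\<close> commutes with the projection, and acts on \<open>v\<close> by \<open>\<mu>\<close>\<close>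
  have stab: "\<rho> h *\<^sub>v w = \<mu> h \<cdot>\<^sub>v w"
    if h: "h \<in> H" and inv: "\<And>a. a \<in> A \<Longrightarrow> \<nu> (inv h \<otimes> a \<otimes> h) = \<nu> a" for h
  proof -
    have "\<rho> h *\<^sub>v w = average A (\<lambda>a. \<nu> (inv h \<otimes> a \<otimes> h)) (\<mu> h \<cdot>\<^sub>v v)"
      unfolding w_def by (simp only: rep_average_conj[OF A carH[OF h] v(1)] v(3)[OF h])
    also have "\<dots> = average A \<nu> (\<mu> h \<cdot>\<^sub>v v)"
      unfolding average_def by (rule vsum_cong) (simp add: inv)
    also have "\<dots> = \<mu> h \<cdot>\<^sub>v w"
      unfolding w_def by (rule average_smult) (use carA v in auto)
    finally show ?thesis .
  qed
  define S where "S = {h \<in> H. \<rho> h *\<^sub>v w = \<mu> h \<cdot>\<^sub>v w}"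
  have S: "subgroup S G"
  proof (rule subgroupI)
    show "S \<subseteq> carrier G" using carH by (auto simp: S_def)
    have "\<one> \<in> S"
      using w H subgroup.one_closed[OF H(1)] by (simp add: S_def mult_char_def)
    then show "S \<noteq> {}" by blast
    fix s assume "s \<in> S"
    then have s: "s \<in> H" "\<rho> s *\<^sub>v w = \<mu> s \<cdot>\<^sub>v w" by (auto simp: S_def)
    have "w = \<rho> (inv s) *\<^sub>v (\<rho> s *\<^sub>v w)"
      using w carH[OF s(1)] by (simp flip: rep_mult)
    also have "\<dots> = \<mu> s \<cdot>\<^sub>v (\<rho> (inv s) *\<^sub>v w)" using s w carH[OF s(1)] by simp
    finally have "\<mu> (inv s) \<cdot>\<^sub>v w = \<mu> (inv s) \<cdot>\<^sub>v (\<mu> s \<cdot>\<^sub>v (\<rho> (inv s) *\<^sub>v w))" by simp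
    also have "\<dots> = \<rho> (inv s) *\<^sub>v w"
      using w carH[OF s(1)] mult_char_cnj[OF fin H s(1)] mult_char_inv[OF fin H s(1)]
      by (simp add: smult_smult_assoc)
    finally show "inv s \<in> S"
      using s(1) subgroup.m_inv_closed[OF H(1)] by (simp add: S_def)
    fix t assume "t \<in> S"
    then have t: "t \<in> H" "\<rho> t *\<^sub>v w = \<mu> t \<cdot>\<^sub>v w" by (auto simp: S_def)
    show "s \<otimes> t \<in> S"
      using s t w carH H subgroup.m_closed[OF H(1)]
      by (simp add: S_def rep_mult mult_char_def smult_smult_assoc mult.commute)
  qed
  interpret second_isomorphism_grp A G S
    using A S by (simp add: second_isomorphism_grp_def second_isomorphism_grp_axioms_def)
  define T where "T = A <#> S"
  have T: "subgroup T G" unfolding T_def by (rule normal_set_mult_subgroup)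
  have AT: "A \<subseteq> T" and ST: "S \<subseteq> T"
    unfolding T_def by (rule H_contained_in_set_mult, rule S_contained_in_set_mult)
  have "\<exists>c. \<rho> t *\<^sub>v w = c \<cdot>\<^sub>v w" if t: "t \<in> T" for t
  proof -
    obtain a s where as: "a \<in> A" "s \<in> S" "t = a \<otimes> s"
      using t by (auto simp: T_def set_mult_def)
    then have "s \<in> H" "\<rho> s *\<^sub>v w = \<mu> s \<cdot>\<^sub>v w" by (auto simp: S_def)
    then have "\<rho> t *\<^sub>v w = (\<mu> s * \<nu> a) \<cdot>\<^sub>v w"
      using as w wA[OF as(1)] carA[OF as(1)] carH by (simp add: rep_mult smult_smult_assoc)
    then show ?thesis by blast
  qed
  then obtain \<psi> where \<psi>: "mult_char G T \<psi>" "\<And>t. t \<in> T \<Longrightarrow> \<rho> t *\<^sub>v w = \<psi> t \<cdot>\<^sub>v w"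
    using eigenvalues_mult_char[OF T w] by blast
  have \<psi>\<nu>: "\<psi> a = \<nu> a" if "a \<in> A" for a
    using \<psi>(2)[of a] wA[OF that] AT that smult_vec_cancel[OF w, of "\<psi> a" "\<nu> a"] by auto
  have conjA: "inv h \<otimes> a \<otimes> h \<in> A" if "h \<in> H" "a \<in> A" for h a
    by (rule inv_op_closed1[OF carH[OF that(1)] that(2)])
  show thesis
  proof (rule that[OF T AT \<psi>(1) w \<psi>(2)])
    fix h assume h: "h \<in> H" "h \<in> T"
    have "\<nu> (inv h \<otimes> a \<otimes> h) = \<nu> a" if "a \<in> A" for a
      using mult_char_conj_invariant[OF T \<psi>(1) h(2), of a] AT that \<psi>\<nu> conjA[OF h(1) that] by auto
    then show "\<psi> h = \<mu> h"
      using stab[OF h(1)] \<psi>(2)[OF h(2)] smult_vec_cancel[OF w, of "\<psi> h" "\<mu> h"] by auto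
  next
    fix h assume h: "h \<in> H" "h \<notin> T"
    then have "\<rho> h *\<^sub>v w \<noteq> \<mu> h \<cdot>\<^sub>v w" using ST by (auto simp: S_def)
    then obtain a where "a \<in> A" "\<nu> (inv h \<otimes> a \<otimes> h) \<noteq> \<nu> a" using stab[OF h(1)] by blast
    then show "\<exists>a\<in>A. \<psi> (inv h \<otimes> a \<otimes> h) \<noteq> \<psi> a"
      using \<psi>\<nu> conjA[OF h(1)] by auto
  qed
qed

text \<open>
  The average over \<open>H\<close> is projected back to the \<open>\<psi>\<close>-eigenspace of \<open>A\<close>. For \<open>h\<close> outside \<open>T\<close> the
  translate of \<open>u\<close> by \<open>h\<close> is an eigenvector of \<open>A\<close> for a different character and is killed; for
  \<open>h\<close> in \<open>T\<close> the summand is \<open>u\<close> itself. What remains is a positive multiple of \<open>u\<close>.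
\<close>

lemma average_nonzero_if_enlarged_eigenvector:
  assumes A: "A \<lhd> G" and T: "subgroup T G" "A \<subseteq> T" "mult_char G T \<psi>"
    and H: "subgroup H G" "mult_char G H \<mu>"
    and agree: "\<And>h. h \<in> H \<Longrightarrow> h \<in> T \<Longrightarrow> \<psi> h = \<mu> h"
    and move: "\<And>h. h \<in> H \<Longrightarrow> h \<notin> T \<Longrightarrow> \<exists>a\<in>A. \<psi> (inv h \<otimes> a \<otimes> h) \<noteq> \<psi> a"
    and u: "u \<in> carrier_vec n" "u \<noteq> 0\<^sub>v n" "\<And>t. t \<in> T \<Longrightarrow> \<rho> t *\<^sub>v u = \<psi> t \<cdot>\<^sub>v u"
  shows "average H \<mu> u \<noteq> 0\<^sub>v n"
proof
  assume zero: "average H \<mu> u = 0\<^sub>v n"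
  have subA: "subgroup A G" by (rule normal_imp_subgroup[OF A])
  have carA: "a \<in> carrier G" if "a \<in> A" for a by (rule subgroup.mem_carrier[OF subA that])
  have carH: "h \<in> carrier G" if "h \<in> H" for h by (rule subgroup.mem_carrier[OF H(1) that])
  have sub: "A \<subseteq> carrier G" "H \<subseteq> carrier G" using carA carH by blast+
  note \<psi>A = mult_char_subset[OF T(3,2)]
  have summand: "average A \<psi> (cnj (\<mu> h) \<cdot>\<^sub>v (\<rho> h *\<^sub>v u)) = (if h \<in> T then of_nat (card A) else 0) \<cdot>\<^sub>v u"
    if h: "h \<in> H" for h
  proof -
    have ev: "\<rho> a *\<^sub>v (\<rho> h *\<^sub>v u) = \<psi> (inv h \<otimes> a \<otimes> h) \<cdot>\<^sub>v (\<rho> h *\<^sub>v u)" if a: "a \<in> A" for a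
    proof -
      have "\<rho> a *\<^sub>v (\<rho> h *\<^sub>v u) = \<rho> h *\<^sub>v (\<rho> (inv h \<otimes> a \<otimes> h) *\<^sub>v u)"
      proof -
        have "h \<otimes> (inv h \<otimes> a \<otimes> h) = a \<otimes> h"
          using carH[OF h] carA[OF a] by (simp flip: m_assoc)
        then show ?thesis using carH[OF h] carA[OF a] u(1) by (simp flip: rep_mult)
      qed
      then show ?thesis
        using normal.inv_op_closed1[OF A carH[OF h] a] T(2) u carH[OF h] by (auto simp: subset_iff)
    qed
    have avg: "average A \<psi> (\<rho> h *\<^sub>v u) =
        (if \<forall>a\<in>A. \<psi> (inv h \<otimes> a \<otimes> h) = \<psi> a then of_nat (card A) \<cdot>\<^sub>v (\<rho> h *\<^sub>v u) else 0\<^sub>v n)"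
      by (rule average_eigenvector[OF subA \<psi>A mult_char_conj[OF A \<psi>A carH[OF h]] _ ev])
        (use u carH[OF h] in auto)
    show ?thesis
    proof (cases "h \<in> T")
      case True
      then have "cnj (\<mu> h) \<cdot>\<^sub>v (\<rho> h *\<^sub>v u) = u"
        using u h agree mult_char_cnj[OF fin H h] by (simp add: smult_smult_assoc)
      moreover have "average A \<psi> u = of_nat (card A) \<cdot>\<^sub>v u"
        using average_eigenvector[OF subA \<psi>A \<psi>A u(1)] u(3) T(2) by auto
      ultimately show ?thesis using True by simp
    next
      case False
      then have "average A \<psi> (\<rho> h *\<^sub>v u) = 0\<^sub>v n" using avg move[OF h] by auto
      then show ?thesis
        using False h u carH sub by (auto simp: average_smult smult_zero_vec)
    qed
  qed
  have "average A \<psi> (average H \<mu> u) = vsum n H (\<lambda>h. average A \<psi> (cnj (\<mu> h) \<cdot>\<^sub>v (\<rho> h *\<^sub>v u)))"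
    unfolding average_def[of H] by (rule average_vsum) (use sub carH u in auto)
  also have "\<dots> = vsum n H (\<lambda>h. (if h \<in> T then of_nat (card A) else 0) \<cdot>\<^sub>v u)"
    by (rule vsum_cong) (rule summand)
  also have "\<dots> = of_nat (card (H \<inter> T) * card A) \<cdot>\<^sub>v u"
    using u(1) finite_subset[OF sub(2) fin] by (simp add: vsum_smult_left flip: sum.inter_restrict)
  finally have "average A \<psi> (average H \<mu> u) = of_nat (card (H \<inter> T) * card A) \<cdot>\<^sub>v u" .
  moreover have "card (H \<inter> T) * card A \<noteq> 0"
    using finite_subset[OF sub(1) fin] finite_subset[OF sub(2) fin]
      subgroup.one_closed[OF subA] subgroup.one_closed[OF H(1)] subgroup.one_closed[OF T(1)]
    by (auto simp: card_eq_0_iff)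
  ultimately have "average A \<psi> (average H \<mu> u) \<noteq> 0\<^sub>v n"
    using smult_vec_nonzero[OF u(1,2)] by (simp only: of_nat_eq_0_iff not_False_eq_True)
  moreover have "average A \<psi> (0\<^sub>v n) = 0\<^sub>v n"
    using average_smult[OF sub(1) u(1), of \<psi> 0] u(1) by (simp add: zero_smult_vec)
  ultimately show False by (simp add: zero)
qed

end

section \<open>Almost monomial groups\<close>

lemma IrrE:
  assumes "group G" "finite (carrier G)" "\<chi> \<in> Irr G"
  obtains \<rho> n where "finite_group_rep G n \<rho>" "\<chi> = afforded_char G \<rho>"
  using assms
  by (auto simp: Irr_def irreducible_representation_def finite_group_rep_def finite_group_rep_axioms_def)

lemma constituents_induced_iff:
  assumes "finite_group_rep G n \<rho>" "afforded_char G \<rho> \<in> Irr G" "subgroup T G" "mult_char G T \<psi>"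
  shows "afforded_char G \<rho> \<in> constituents G (induced_char G T \<psi>) \<longleftrightarrow>
    (\<exists>x \<in> carrier_vec n. x \<noteq> 0\<^sub>v n \<and> (\<forall>t\<in>T. \<rho> t *\<^sub>v x = \<psi> t \<cdot>\<^sub>v x))"
  using assms(2) finite_group_rep.char_inner_induced_pos_iff[OF assms(1,3,4)]
  by (simp add: constituents_def)

theorem theorem4p8:
  fixes G :: "('a, 'b) monoid_scheme" and A :: "'a set"
  assumes "group G" and "finite (carrier G)"
    and "A \<lhd> G" and "comm_group (G\<lparr>carrier := A\<rparr>)"
    and "almost_monomial G"
  shows "relative_almost_monomial G A"
  unfolding relative_almost_monomial_def
proof (intro ballI impI)
  fix \<chi> \<phi> assume \<chi>: "\<chi> \<in> Irr G" and \<phi>: "\<phi> \<in> Irr G" and "\<chi> \<noteq> \<phi>"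
  have A: "subgroup A G" by (rule normal_imp_subgroup[OF assms(3)])
  have comm: "a \<otimes>\<^bsub>G\<^esub> b = b \<otimes>\<^bsub>G\<^esub> a" if "a \<in> A" "b \<in> A" for a b
    using comm_monoid.m_comm[OF comm_group.axioms(1)[OF assms(4)]] that by simp
  obtain H \<mu> where H: "subgroup H G" and \<mu>: "\<mu> \<in> linear_characters (G\<lparr>carrier := H\<rparr>)"
    and \<chi>H: "\<chi> \<in> constituents G (induced_char G H \<mu>)"
    and \<phi>H: "\<phi> \<notin> constituents G (induced_char G H \<mu>)"
    using assms(5) \<chi> \<phi> \<open>\<chi> \<noteq> \<phi>\<close> unfolding almost_monomial_def by blast
  note \<mu>H = linear_characters_mult_char[OF H \<mu>]
  obtain \<rho> n where \<rho>: "finite_group_rep G n \<rho>" "\<chi> = afforded_char G \<rho>"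
    using IrrE[OF assms(1,2) \<chi>] .
  obtain \<sigma> m where \<sigma>: "finite_group_rep G m \<sigma>" "\<phi> = afforded_char G \<sigma>"
    using IrrE[OF assms(1,2) \<phi>] .
  interpret R: finite_group_rep G n \<rho> by (rule \<rho>(1))
  interpret S: finite_group_rep G m \<sigma> by (rule \<sigma>(1))
  obtain v where v: "v \<in> carrier_vec n" "v \<noteq> 0\<^sub>v n" "\<And>h. h \<in> H \<Longrightarrow> \<rho> h *\<^sub>v v = \<mu> h \<cdot>\<^sub>v v"
    using \<chi>H constituents_induced_iff[OF \<rho>(1) _ H \<mu>H] \<chi> by (auto simp: \<rho>(2))
  obtain T \<psi> w where T: "subgroup T G" "A \<subseteq> T" "mult_char G T \<psi>"
    and w: "w \<in> carrier_vec n" "w \<noteq> 0\<^sub>v n" "\<And>t. t \<in> T \<Longrightarrow> \<rho> t *\<^sub>v w = \<psi> t \<cdot>\<^sub>v w"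
    and agree: "\<And>h. h \<in> H \<Longrightarrow> h \<in> T \<Longrightarrow> \<psi> h = \<mu> h"
    and move: "\<And>h. h \<in> H \<Longrightarrow> h \<notin> T \<Longrightarrow> \<exists>a\<in>A. \<psi> (inv\<^bsub>G\<^esub> h \<otimes>\<^bsub>G\<^esub> a \<otimes>\<^bsub>G\<^esub> h) \<noteq> \<psi> a"
    using R.enlarge_linear_character[OF assms(3) comm H \<mu>H v] by blast
  let ?\<psi> = "restrict \<psi> T"
  have \<psi>T: "mult_char G T ?\<psi>" by (rule mult_char_restrict[OF T(1,3)])
  have "restrict ?\<psi> A = restrict \<psi> A" using T(2) by (auto simp: fun_eq_iff)
  then have "restrict ?\<psi> A \<in> Irr (G\<lparr>carrier := A\<rparr>)"
    using mult_char_Irr[OF A mult_char_subset[OF T(3,2)]] by simp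
  moreover have "?\<psi> \<in> Irr (G\<lparr>carrier := T\<rparr>)" by (rule mult_char_Irr[OF T(1,3)])
  moreover have "\<chi> \<in> constituents G (induced_char G T ?\<psi>)"
    using constituents_induced_iff[OF \<rho>(1) _ T(1) \<psi>T] \<chi> w by (auto simp: \<rho>(2))
  moreover have "\<phi> \<notin> constituents G (induced_char G T ?\<psi>)"
  proof
    assume "\<phi> \<in> constituents G (induced_char G T ?\<psi>)"
    then obtain u where u: "u \<in> carrier_vec m" "u \<noteq> 0\<^sub>v m" "\<And>t. t \<in> T \<Longrightarrow> \<sigma> t *\<^sub>v u = \<psi> t \<cdot>\<^sub>v u"
      using constituents_induced_iff[OF \<sigma>(1) _ T(1) \<psi>T] \<phi> by (auto simp: \<sigma>(2))
    have "S.average H \<mu> u \<noteq> 0\<^sub>v m"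
      by (rule S.average_nonzero_if_enlarged_eigenvector[OF assms(3) T H \<mu>H agree move u])
    moreover have "\<forall>h\<in>H. \<sigma> h *\<^sub>v S.average H \<mu> u = \<mu> h \<cdot>\<^sub>v S.average H \<mu> u"
      using S.rep_average[OF H \<mu>H _ u(1)] by blast
    ultimately have "\<phi> \<in> constituents G (induced_char G H \<mu>)"
      using constituents_induced_iff[OF \<sigma>(1) _ H \<mu>H] \<phi> S.average_carrier by (auto simp: \<sigma>(2))
    then show False using \<phi>H by contradiction
  qed
  ultimately show "\<exists>H \<psi>. subgroup H G \<and> A \<subseteq> H \<and> \<psi> \<in> Irr (G\<lparr>carrier := H\<rparr>) \<and>
      restrict \<psi> A \<in> Irr (G\<lparr>carrier := A\<rparr>) \<and>
      \<chi> \<in> constituents G (induced_char G H \<psi>) \<and> \<phi> \<notin> constituents G (induced_char G H \<psi>)"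
    using T(1,2) by blast
qed

end
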